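(* Let $i\ge 2$ and let $B_{i+1}$ be a bouquet with $i+1$ edges whose intersection graph $I(B_{i+1})$ is the complete bipartite graph $K_{i,1}$. Then $$^{\partial}\varepsilon_{B_{i+1}}^{\times}(z)=z^{i}+z^{i+1}+2z^2\left[(1+z)^{i}-z^i\right].$$
   Context: A ribbon graph $G$ is a surface with boundary represented as the union of two finite sets of closed topological discs, vertex-discs $V(G)$ and edge-ribbons $E(G)$, such that: vertex-discs and edge-ribbons intersect in disjoint line segments; each such segment lies on the boundary of precisely one vertex-disc and precisely one edge-ribbon; every edge-ribbon contains exactly two such segments. All graphs are connected (loops and multiple edges allowed). Let $F(G)$ be the set of faces (boundary components of the surface) and $c(G)$ the number of connected components. The Euler genus is $\varepsilon(G)=2c(G)-|V(G)|+|E(G)|-|F(G)|$. For $A\subseteq E(G)$, the partial Petrial $G^{\times|A}$ is obtained by detaching one end of each edge-ribbon in $A$ from its incident vertex-disc, giving the edge a half-twist, and reattaching it. The partial Petrial polynomial is $^{\partial}\varepsilon_G^{\times}(z)=\sum_{A\subseteq E(G)}z^{\varepsilon(G^{\times|A})}$. A bouquet is a ribbon graph with exactly one vertex-disc. Two edges (loops) of a bouquet are interlaced if their half-edges alternate in the cyclic order of half-edges around the vertex-disc. The intersection graph $I(B)$ of a bouquet $B$ has the loops of $B$ as vertices, two being adjacent if and only if the loops are interlaced. *)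

theory Defs
  imports
    "Graph_Theory.Kuratowski"
    "HOL-Computational_Algebra.Polynomial"
begin

section \<open>Ribbon graphs\<close>

text \<open>
  A ribbon graph is given by the cell structure of its discs.  A \<^emph>\<open>corner\<close> is an end point of one of
  the line segments in which a vertex-disc meets an edge-ribbon.  The corners cut the boundary
  circles of the discs into three kinds of arcs, and every corner is an end point of exactly one
  arc of each kind:
  \<^item> the common line segments of a vertex-disc and an edge-ribbon,
  \<^item> the free sides of the edge-ribbons,
  \<^item> the free arcs of the vertex-discs.
  The functions \<open>seg\<close>, \<open>side\<close> and \<open>gap\<close> send a corner to the other end point of the arc of the first,
  second and third kind, respectively.  A vertex-disc without corners is an isolated vertex.
\<close>

record ('v, 'e, 'c) ribbon_struct =
  vdiscs :: "'v set"
  ribbons :: "'e set"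
  corners :: "'c set"
  disc_of :: "'c \<Rightarrow> 'v"
  ribbon_of :: "'c \<Rightarrow> 'e"
  seg :: "'c \<Rightarrow> 'c"
  side :: "'c \<Rightarrow> 'c"
  gap :: "'c \<Rightarrow> 'c"

definition arc_involution :: "'c set \<Rightarrow> ('c \<Rightarrow> 'c) \<Rightarrow> bool" where
  "arc_involution C f \<longleftrightarrow> (\<forall>c\<in>C. f c \<in> C \<and> f c \<noteq> c \<and> f (f c) = c)"

text \<open>Two corners are related if one can walk between them along arcs of the kinds \<open>f\<close> and \<open>g\<close>.\<close>

definition curve_rel :: "'c set \<Rightarrow> ('c \<Rightarrow> 'c) \<Rightarrow> ('c \<Rightarrow> 'c) \<Rightarrow> 'c rel" where
  "curve_rel C f g = {(c, d) \<in> C \<times> C. (c, d) \<in> ({(x, f x) |x. x \<in> C} \<union> {(x, g x) |x. x \<in> C})\<^sup>*}"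

definition half_edges :: "('v, 'e, 'c) ribbon_struct \<Rightarrow> 'c set set" where
  "half_edges G = {{c, seg G c} |c. c \<in> corners G}"

locale ribbon_graph =
  fixes G :: "('v, 'e, 'c) ribbon_struct"
  assumes finite_vdiscs: "finite (vdiscs G)"
    and finite_ribbons: "finite (ribbons G)"
    and finite_corners: "finite (corners G)"
    and disc_of_in: "c \<in> corners G \<Longrightarrow> disc_of G c \<in> vdiscs G"
    and ribbon_of_in: "c \<in> corners G \<Longrightarrow> ribbon_of G c \<in> ribbons G"
    and seg_inv: "arc_involution (corners G) (seg G)"
    and side_inv: "arc_involution (corners G) (side G)"
    and gap_inv: "arc_involution (corners G) (gap G)"
    and disc_of_seg: "c \<in> corners G \<Longrightarrow> disc_of G (seg G c) = disc_of G c"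
    and ribbon_of_seg: "c \<in> corners G \<Longrightarrow> ribbon_of G (seg G c) = ribbon_of G c"
    and ribbon_of_side: "c \<in> corners G \<Longrightarrow> ribbon_of G (side G c) = ribbon_of G c"
    and disc_of_gap: "c \<in> corners G \<Longrightarrow> disc_of G (gap G c) = disc_of G c"
    \<comment> \<open>the boundary of a disc is a single circle\<close>
    and disc_boundary: "c \<in> corners G \<Longrightarrow> d \<in> corners G \<Longrightarrow> disc_of G c = disc_of G d
      \<Longrightarrow> (c, d) \<in> curve_rel (corners G) (seg G) (gap G)"
    and ribbon_boundary: "c \<in> corners G \<Longrightarrow> d \<in> corners G \<Longrightarrow> ribbon_of G c = ribbon_of G d
      \<Longrightarrow> (c, d) \<in> curve_rel (corners G) (seg G) (side G)"
    and two_segments: "e \<in> ribbons G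
      \<Longrightarrow> card {{c, seg G c} |c. c \<in> corners G \<and> ribbon_of G c = e} = 2"

text \<open>
  A boundary component of the surface is the boundary of an isolated vertex-disc, or it is
  composed alternately of free sides of edge-ribbons and free arcs of vertex-discs.
\<close>

definition faces :: "('v, 'e, 'c) ribbon_struct \<Rightarrow> ('v + 'c set) set" where
  "faces G = (vdiscs G - disc_of G ` corners G)
    <+> (corners G // curve_rel (corners G) (side G) (gap G))"

definition underlying_graph :: "('v, 'e, 'c) ribbon_struct \<Rightarrow> ('v, 'c) pre_digraph" where
  "underlying_graph G = \<lparr> verts = vdiscs G, arcs = corners G,
     tail = disc_of G, head = (\<lambda>c. disc_of G (side G c)) \<rparr>"

definition num_components :: "('v, 'e, 'c) ribbon_struct \<Rightarrow> nat" where
  "num_components G = card (pre_digraph.sccs_verts (underlying_graph G))"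

definition euler_genus :: "('v, 'e, 'c) ribbon_struct \<Rightarrow> int" where
  "euler_genus G = 2 * int (num_components G) - int (card (vdiscs G))
     + int (card (ribbons G)) - int (card (faces G))"


section \<open>Partial Petrials\<close>

text \<open>
  Detaching the end \<open>{a, seg a}\<close> of a ribbon with free sides from \<open>a\<close> to \<open>side a\<close> and from
  \<open>seg a\<close> to \<open>side (seg a)\<close>, and reattaching it after a half-twist, exchanges \<open>a\<close> with \<open>seg a\<close>
  as end points of these sides.  As \<open>seg\<close> and \<open>side\<close> commute on a ribbon, the new sides join every
  corner \<open>c\<close> of the ribbon to \<open>seg (side c)\<close>, whichever end has been twisted.
\<close>

definition partial_petrial ::
  "('v, 'e, 'c) ribbon_struct \<Rightarrow> 'e set \<Rightarrow> ('v, 'e, 'c) ribbon_struct" where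
  "partial_petrial G A =
     G\<lparr>side := (\<lambda>c. if ribbon_of G c \<in> A then seg G (side G c) else side G c)\<rparr>"

text \<open>The Euler genus of a ribbon graph is nonnegative, so \<open>nat\<close> truncates nothing.\<close>

definition partial_petrial_poly :: "('v, 'e, 'c) ribbon_struct \<Rightarrow> int poly" where
  "partial_petrial_poly G = (\<Sum>A\<in>Pow (ribbons G). monom 1 (nat (euler_genus (partial_petrial G A))))"


section \<open>Bouquets and intersection graphs\<close>

definition bouquet :: "('v, 'e, 'c) ribbon_struct \<Rightarrow> bool" where
  "bouquet B \<longleftrightarrow> ribbon_graph B \<and> card (vdiscs B) = 1"

text \<open>
  Walking around a vertex-disc, one crosses the segment at \<open>c\<close> and then a free arc to reach the
  next half-edge.  The iterates of this map starting at a corner traverse the half-edges at the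
  vertex-disc in their cyclic order.
\<close>

definition next_half_edge :: "('v, 'e, 'c) ribbon_struct \<Rightarrow> 'c \<Rightarrow> 'c" where
  "next_half_edge G c = gap G (seg G c)"

text \<open>
  For loops of a bouquet: in one turn around the vertex-disc, starting at a suitable half-edge
  of \<open>e\<close>, one meets half-edges of \<open>e\<close>, \<open>f\<close>, \<open>e\<close>, \<open>f\<close> in this order.
\<close>

definition interlaced :: "('v, 'e, 'c) ribbon_struct \<Rightarrow> 'e \<Rightarrow> 'e \<Rightarrow> bool" where
  "interlaced B e f \<longleftrightarrow> e \<noteq> f \<and>
     (\<exists>c\<in>corners B. \<exists>p q r. 0 < p \<and> p < q \<and> q < r \<and> r < card (half_edges B)
        \<and> ribbon_of B c = e
        \<and> ribbon_of B ((next_half_edge B ^^ p) c) = f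
        \<and> ribbon_of B ((next_half_edge B ^^ q) c) = e
        \<and> ribbon_of B ((next_half_edge B ^^ r) c) = f)"

text \<open>As in the graph library, an undirected graph is a symmetric digraph.\<close>

definition intersection_graph :: "('v, 'e, 'c) ribbon_struct \<Rightarrow> 'e pair_pre_digraph" where
  "intersection_graph B = \<lparr> pverts = ribbons B,
     parcs = {(e, f) \<in> ribbons B \<times> ribbons B. interlaced B e f} \<rparr>"

end

theory Submission
  imports Defs
begin

text \<open>
  The faces of a bouquet are counted by colouring them with two colours.  A set of corners that is
  a union of faces is a function \<open>\<phi>\<close> from the corners to \<open>GF(2)\<close> that is constant along the free sides
  and along the free arcs of the vertex-disc, so there are \<open>2\<^sup>F\<close> of them if there are \<open>F\<close> faces.
  Crossing the segment at a corner \<open>c\<close> changes \<open>\<phi>\<close> by \<open>x = \<phi> c + \<phi> (seg c)\<close>, and as \<open>seg\<close> and \<open>side\<close>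
  commute, \<open>x\<close> depends only on the ribbon at \<open>c\<close>.  Walking once around the vertex-disc, one recovers
  \<open>\<phi>\<close> from its value at one corner and from the set \<open>X\<close> of the ribbons with \<open>x = 1\<close>; each ribbon is
  met twice, so the walk closes up for every \<open>X\<close>.  What remains is that \<open>\<phi>\<close> be constant along the
  two sides of each ribbon \<open>e\<close>.  Between its two ends the colour changes once for each end of
  a ribbon in \<open>X\<close>; ribbons that are not interlaced with \<open>e\<close> contribute zero or two changes, the
  interlaced ones contribute one.  So the condition at \<open>e\<close> is that the number of ribbons of \<open>X\<close>
  interlaced with \<open>e\<close>, plus one if \<open>e\<close> is a twisted ribbon in \<open>X\<close>, is even.  In other words, \<open>X\<close> is in
  the kernel over \<open>GF(2)\<close> of the adjacency matrix of the intersection graph with a diagonal entry \<open>1\<close>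
  for each twisted ribbon, and \<open>2\<^sup>F\<close> is twice the size of this kernel (\<open>two_power_faces\<close>).  Hence the
  Euler genus is the rank of that matrix.

  A partial Petrial has the same half-edges in the same cyclic order, and it changes the diagonal
  exactly at the ribbons of \<open>A\<close> (\<open>twisted_partial_petrial\<close>).  So as \<open>A\<close> runs through all sets of
  ribbons, the diagonal runs through all 0-1-vectors, once each.  For a star with hub \<open>h\<close> and \<open>i\<close> leaves
  the kernels are easily listed.  If \<open>k < i\<close> leaves are twisted, then an untwisted leaf forces the hub
  out of \<open>X\<close>, and \<open>X\<close> is any set of evenly many untwisted leaves: the rank is \<open>k + 2\<close>, whether the hub is
  twisted or not.  If all leaves are twisted, then \<open>X\<close> is empty or contains everything, the latter for
  exactly one of the two types of hub: the ranks are \<open>i\<close> and \<open>i + 1\<close>.  Summing \<open>2 z\<^sup>2 z\<^sup>k\<close> over the proper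
  subsets of the leaves gives the bracket of the theorem by the binomial theorem
  (\<open>sum_monom_star_rank\<close>).
\<close>

section \<open>Curves as equivalence classes of corners\<close>

lemma equiv_curve_rel:
  assumes f: "arc_involution C f" and g: "arc_involution C g"
  shows "equiv C (curve_rel C f g)"
proof (rule equivI)
  let ?R = "{(x, f x) |x. x \<in> C} \<union> {(x, g x) |x. x \<in> C}"
  show "curve_rel C f g \<subseteq> C \<times> C" "refl_on C (curve_rel C f g)"
    by (auto simp: curve_rel_def refl_on_def)
  have "sym ?R"
  proof (rule symI)
    fix x y assume "(x, y) \<in> ?R"
    then show "(y, x) \<in> ?R"
      using f g unfolding arc_involution_def by fastforce
  qed
  then have "sym (?R\<^sup>*)"
    by (rule sym_rtrancl)
  then show "sym (curve_rel C f g)"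
    by (auto simp: curve_rel_def sym_def)
  show "trans (curve_rel C f g)"
    by (auto simp: curve_rel_def trans_def)
qed

lemma curve_rel_least:
  assumes cd: "(c, d) \<in> curve_rel C f g" and c: "c \<in> S"
    and S: "\<And>x. x \<in> C \<Longrightarrow> x \<in> S \<Longrightarrow> f x \<in> S \<and> g x \<in> S"
  shows "d \<in> S"
proof -
  let ?R = "{(x, f x) |x. x \<in> C} \<union> {(x, g x) |x. x \<in> C}"
  have "(c, d) \<in> ?R\<^sup>*"
    using cd by (auto simp: curve_rel_def)
  then show ?thesis
    using c by induction (use S in auto)
qed

lemma curve_rel_step:
  assumes "arc_involution C f" "arc_involution C g" "c \<in> C"
  shows "(c, f c) \<in> curve_rel C f g" "(c, g c) \<in> curve_rel C f g"
  using assms by (auto simp: curve_rel_def arc_involution_def)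

text \<open>
  A saturated subset is the union of an arbitrary set of equivalence classes.
\<close>

lemma card_saturated_subsets:
  assumes "equiv A r" "finite A"
  shows "card {S. S \<subseteq> A \<and> r `` S \<subseteq> S} = 2 ^ card (A // r)"
proof -
  have r: "r \<subseteq> A \<times> A"
    using assms(1) by (rule equiv_type)
  have inj: "inj_on Union (Pow (A // r))"
  proof (rule inj_on_inverseI)
    fix P assume P: "P \<in> Pow (A // r)"
    show "{K \<in> A // r. K \<subseteq> \<Union>P} = P"
    proof (intro equalityI subsetI)
      fix K assume "K \<in> {K \<in> A // r. K \<subseteq> \<Union>P}"
      then have K: "K \<in> A // r" "K \<subseteq> \<Union>P" by auto
      obtain x where x: "x \<in> K"
        using K(1) in_quotient_imp_non_empty[OF assms(1)] by fastforce
      then obtain K' where K': "K' \<in> P" "x \<in> K'" using K by auto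
      then have "K = K'"
        using quotient_disj[OF assms(1) K(1), of K'] P x by auto
      with K' show "K \<in> P" by simp
    qed (use P in auto)
  qed
  have "Union ` Pow (A // r) = {S. S \<subseteq> A \<and> r `` S \<subseteq> S}"
  proof (intro equalityI subsetI)
    fix S assume "S \<in> Union ` Pow (A // r)"
    then obtain P where P: "P \<subseteq> A // r" "S = \<Union>P" by auto
    have "r `` K \<subseteq> K" "K \<subseteq> A" if "K \<in> P" for K
      using that P in_quotient_imp_closed[OF assms(1), of K] in_quotient_imp_subset[OF assms(1), of K]
      by auto
    then show "S \<in> {S. S \<subseteq> A \<and> r `` S \<subseteq> S}"
      unfolding P by blast
  next
    fix S assume S: "S \<in> {S. S \<subseteq> A \<and> r `` S \<subseteq> S}"
    have "S = \<Union>((\<lambda>x. r `` {x}) ` S)"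
      using S equiv_class_self[OF assms(1)] by blast
    moreover have "(\<lambda>x. r `` {x}) ` S \<subseteq> A // r"
      using S by (auto intro: quotientI)
    ultimately show "S \<in> Union ` Pow (A // r)"
      by blast
  qed
  then show ?thesis
    using card_image[OF inj] card_Pow[of "A // r"] finite_quotient[OF assms(2) r] by simp
qed

section \<open>Ribbons and their partial Petrials\<close>

context ribbon_graph
begin

lemma seg_simps [simp]:
  "c \<in> corners G \<Longrightarrow> seg G c \<in> corners G" "c \<in> corners G \<Longrightarrow> seg G c \<noteq> c"
  "c \<in> corners G \<Longrightarrow> seg G (seg G c) = c"
  using seg_inv by (auto simp: arc_involution_def)

lemma side_simps [simp]:
  "c \<in> corners G \<Longrightarrow> side G c \<in> corners G" "c \<in> corners G \<Longrightarrow> side G c \<noteq> c"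
  "c \<in> corners G \<Longrightarrow> side G (side G c) = c"
  using side_inv by (auto simp: arc_involution_def)

lemma gap_simps [simp]:
  "c \<in> corners G \<Longrightarrow> gap G c \<in> corners G" "c \<in> corners G \<Longrightarrow> gap G c \<noteq> c"
  "c \<in> corners G \<Longrightarrow> gap G (gap G c) = c"
  using gap_inv by (auto simp: arc_involution_def)

declare ribbon_of_in [simp] ribbon_of_seg [simp] ribbon_of_side [simp] disc_of_in [simp]

text \<open>
  Otherwise the boundary of the ribbon would already close up after one segment and one side, and
  there would be no room for the second segment.
\<close>

lemma side_neq_seg:
  assumes c: "c \<in> corners G"
  shows "side G c \<noteq> seg G c"
proof
  assume eq: "side G c = seg G c"
  have "d \<in> {c, seg G c}" if d: "d \<in> corners G" "ribbon_of G d = ribbon_of G c" for d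
    by (rule curve_rel_least[OF ribbon_boundary[of c d]])
       (use c d eq side_simps(3)[OF c] in auto)
  then have "{{d, seg G d} |d. d \<in> corners G \<and> ribbon_of G d = ribbon_of G c} = {{c, seg G c}}"
    using c by (intro equalityI subsetI) (fastforce simp: insert_commute)+
  with two_segments[of "ribbon_of G c"] c show False
    by simp
qed

text \<open>
  The two segments at \<open>c\<close> and at \<open>side c\<close> are distinct, so they are the two segments of the ribbon.
\<close>

lemma ribbon_corners:
  assumes "c \<in> corners G" "d \<in> corners G" "ribbon_of G d = ribbon_of G c"
  shows "d \<in> {c, seg G c, side G c, seg G (side G c)}"
proof -
  let ?H = "{{d, seg G d} |d. d \<in> corners G \<and> ribbon_of G d = ribbon_of G c}"
  have "card ?H = 2"
    using two_segments[of "ribbon_of G c"] assms by simp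
  moreover have "{{c, seg G c}, {side G c, seg G (side G c)}} \<subseteq> ?H"
  proof -
    have "{x, seg G x} \<in> ?H" if "x \<in> {c, side G c}" for x
      using that assms by auto
    then show ?thesis by simp
  qed
  moreover have "{c, seg G c} \<noteq> {side G c, seg G (side G c)}"
    using assms side_neq_seg[of c] by (metis doubleton_eq_iff side_simps(2))
  ultimately have "{{c, seg G c}, {side G c, seg G (side G c)}} = ?H"
    by (intro card_subset_eq) (auto intro: card_ge_0_finite)
  moreover have "{d, seg G d} \<in> ?H"
    using assms by auto
  ultimately have "{d, seg G d} \<in> {{c, seg G c}, {side G c, seg G (side G c)}}"
    by simp
  then show ?thesis
    by (auto simp: doubleton_eq_iff)
qed

text \<open>
  The side starting at \<open>seg c\<close> must end at a corner of the ribbon other than the ends \<open>c\<close> and \<open>side c\<close>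
  of the other side.
\<close>

lemma side_seg:
  assumes c: "c \<in> corners G"
  shows "side G (seg G c) = seg G (side G c)"
proof -
  have "side G (seg G c) \<in> {c, seg G c, side G c, seg G (side G c)}"
    by (rule ribbon_corners) (use c in auto)
  moreover have "side G (seg G c) \<noteq> c" "side G (seg G c) \<noteq> side G c"
    using side_neq_seg c by (metis seg_simps(1) side_simps(3), metis seg_simps(1,2) side_simps(3))
  ultimately show ?thesis
    using c by simp
qed

lemma ribbon_graph_partial_petrial: "ribbon_graph (partial_petrial G A)"
proof -
  let ?P = "partial_petrial G A"
  have P [simp]: "vdiscs ?P = vdiscs G" "ribbons ?P = ribbons G" "corners ?P = corners G"
    "disc_of ?P = disc_of G" "ribbon_of ?P = ribbon_of G" "seg ?P = seg G" "gap ?P = gap G"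
    by (simp_all add: partial_petrial_def)
  have sideP: "side ?P c = (if ribbon_of G c \<in> A then seg G (side G c) else side G c)" for c
    by (simp add: partial_petrial_def)
  have inv: "arc_involution (corners G) (side ?P)"
    using side_neq_seg by (auto simp: arc_involution_def sideP side_seg) (metis seg_simps(3) side_simps(1))
  show ?thesis
  proof (unfold_locales, unfold P)
    fix c d assume cd: "c \<in> corners G" "d \<in> corners G" "ribbon_of G c = ribbon_of G d"
    let ?r = "curve_rel (corners G) (seg G) (side ?P)"
    note step = curve_rel_step[OF seg_inv inv] and eq = equiv_curve_rel[OF seg_inv inv]
    have "{c, seg G c, side ?P c, seg G (side ?P c)} = {c, seg G c, side G c, seg G (side G c)}"
      using cd by (auto simp: sideP)
    then have d: "d \<in> {c, seg G c, side ?P c, seg G (side ?P c)}"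
      using ribbon_corners[of c d] cd by simp
    have "side ?P c \<in> corners G"
      using cd by (simp add: sideP)
    then have "(side ?P c, seg G (side ?P c)) \<in> ?r" "(c, side ?P c) \<in> ?r" "(c, seg G c) \<in> ?r"
      "(c, c) \<in> ?r"
      using step cd eq by (auto simp: equiv_def refl_on_def)
    then show "(c, d) \<in> ?r"
      using d equivE[OF eq] by (auto dest: transD)
  qed (use finite_vdiscs finite_ribbons finite_corners seg_inv inv gap_inv disc_of_seg disc_of_gap
         disc_boundary two_segments in \<open>auto simp: sideP\<close>)
qed

end

section \<open>Half-edges around the vertex-disc\<close>

text \<open>
  Here \<open>p < q\<close> and \<open>u < v\<close> are the positions of two letters in a cyclic word of length \<open>n\<close>, which is
  read from \<open>x\<^sub>0\<close> on for less than one turn.  If the two letters are read alternately, then exactly one of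
  \<open>u\<close> and \<open>v\<close> lies between \<open>p\<close> and \<open>q\<close>.
\<close>

lemma separated_if_alternating:
  fixes x\<^sub>0 x\<^sub>1 x\<^sub>2 x\<^sub>3 p q u v n :: nat
  assumes x: "x\<^sub>0 < x\<^sub>1" "x\<^sub>1 < x\<^sub>2" "x\<^sub>2 < x\<^sub>3" "x\<^sub>3 < x\<^sub>0 + n"
    and bounds: "p < q" "q < n" "u < v" "v < n"
    and e: "x\<^sub>0 \<in> {p, q}" "x\<^sub>2 \<in> {p, q, p + n, q + n}"
    and f: "x\<^sub>1 \<in> {u, v, u + n, v + n}" "x\<^sub>3 \<in> {u, v, u + n, v + n}"
  shows "(p < u \<and> u < q) \<noteq> (p < v \<and> v < q)"
proof (cases "x\<^sub>0 = p")
  case True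
  then have "x\<^sub>2 \<noteq> p" "x\<^sub>2 \<noteq> p + n" "x\<^sub>2 \<noteq> q + n"
    using x bounds(1) by linarith+
  then have q: "x\<^sub>2 = q" using e by simp
  have "x\<^sub>1 \<noteq> u + n" "x\<^sub>1 \<noteq> v + n"
    using x q bounds(2) by linarith+
  then consider "x\<^sub>1 = u" | "x\<^sub>1 = v" using f(1) by blast
  then show ?thesis
  proof cases
    case 1
    then have "x\<^sub>3 \<noteq> u" "x\<^sub>3 \<noteq> u + n" "x\<^sub>3 \<noteq> v + n" using x True bounds(3) by linarith+
    then have "x\<^sub>3 = v" using f(2) by blast
    then show ?thesis using 1 x True q by simp
  next
    case 2
    then have "x\<^sub>3 \<noteq> u" "x\<^sub>3 \<noteq> v" "x\<^sub>3 \<noteq> v + n" using x True bounds(3) by linarith+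
    then have "x\<^sub>3 = u + n" using f(2) by blast
    then have "u < p" using x True by linarith
    then show ?thesis using 2 x True q by simp
  qed
next
  case False
  then have q: "x\<^sub>0 = q" using e by simp
  then have "x\<^sub>2 \<noteq> p" "x\<^sub>2 \<noteq> q" "x\<^sub>2 \<noteq> q + n"
    using x bounds(1) by linarith+
  then have p: "x\<^sub>2 = p + n" using e by simp
  have "x\<^sub>3 \<noteq> u" "x\<^sub>3 \<noteq> v"
    using x p bounds(3,4) by linarith+
  then consider "x\<^sub>3 = u + n" | "x\<^sub>3 = v + n" using f(2) by blast
  then show ?thesis
  proof cases
    case 1
    then have "x\<^sub>1 \<noteq> u" "x\<^sub>1 \<noteq> u + n" "x\<^sub>1 \<noteq> v + n" using x p q bounds by linarith+
    then have "x\<^sub>1 = v" using f(1) by blast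
    then show ?thesis using 1 x p q by simp
  next
    case 2
    then have "x\<^sub>1 \<noteq> v" "x\<^sub>1 \<noteq> v + n" using x p q bounds by linarith+
    then consider "x\<^sub>1 = u" | "x\<^sub>1 = u + n" using f(1) by blast
    then show ?thesis
    proof cases
      case 1
      then show ?thesis using 2 x p q by simp
    next
      case u: 2
      then have "u < p" using x p by linarith
      then show ?thesis using 2 x p q by simp
    qed
  qed
qed

text \<open>
  A base corner selects one of the two directions around the vertex-disc and a first half-edge.
  Relative to it every corner is either of the form \<open>corner_at k\<close>, the corner at which the \<open>k\<close>-th
  half-edge is entered, or of the form \<open>seg (corner_at k)\<close>, the corner at which it is left.  The cyclic
  sequence of the ribbons met on the way is \<open>word\<close>, the double occurrence word of the bouquet.
\<close>

locale based_bouquet = ribbon_graph G for G :: "('v, 'e, 'c) ribbon_struct" +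
  fixes base :: 'c
  assumes one_disc: "card (vdiscs G) = 1"
    and base_in: "base \<in> corners G"
begin

definition corner_at :: "nat \<Rightarrow> 'c" where
  "corner_at k = (next_half_edge G ^^ k) base"

definition word :: "nat \<Rightarrow> 'e" where
  "word k = ribbon_of G (corner_at k)"

abbreviation period :: nat where
  "period \<equiv> card (half_edges G)"

lemma next_half_edge_in [simp]: "c \<in> corners G \<Longrightarrow> next_half_edge G c \<in> corners G"
  by (simp add: next_half_edge_def)

lemma corner_at_in [simp]: "corner_at k \<in> corners G"
  unfolding corner_at_def by (induction k) (use base_in in auto)

lemma corner_at_0: "corner_at 0 = base"
  by (simp add: corner_at_def)

lemma corner_at_Suc: "corner_at (Suc k) = gap G (seg G (corner_at k))"
  by (simp add: corner_at_def next_half_edge_def)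

lemma funpow_next_corner_at: "(next_half_edge G ^^ m) (corner_at k) = corner_at (m + k)"
  by (simp add: corner_at_def funpow_add)

lemma gap_corner_at_Suc: "gap G (corner_at (Suc k)) = seg G (corner_at k)"
  by (simp add: corner_at_Suc)

lemma corner_at_cancel: "corner_at (a + m) = corner_at (b + m) \<Longrightarrow> corner_at a = corner_at b"
proof (induction m)
  case (Suc m)
  then have "seg G (gap G (corner_at (Suc (a + m)))) = seg G (gap G (corner_at (Suc (b + m))))"
    by simp
  then show ?case
    by (intro Suc.IH) (simp add: gap_corner_at_Suc)
qed simp

text \<open>
  The map \<open>seg\<close> reverses the direction of the walk, so if \<open>m\<close> steps from \<open>c\<close> led to \<open>seg c\<close>, then \<open>m - 2\<close>
  steps would lead from the successor \<open>d\<close> of \<open>c\<close> to \<open>seg d\<close>.  In the end \<open>seg\<close> or \<open>gap\<close> would have a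
  fixed point.
\<close>

lemma funpow_next_neq_seg: "c \<in> corners G \<Longrightarrow> (next_half_edge G ^^ m) c \<noteq> seg G c"
proof (induction m arbitrary: c rule: less_induct)
  case (less m)
  consider "m = 0" | "m = 1" | l where "m = Suc (Suc l)"
    by (metis One_nat_def not0_implies_Suc)
  then show ?case
  proof cases
    case 1
    then show ?thesis using seg_simps(2)[OF less.prems] by simp
  next
    case 2
    then show ?thesis using less.prems by (simp add: next_half_edge_def)
  next
    case 3
    let ?d = "next_half_edge G c"
    have "seg G (gap G ((next_half_edge G ^^ m) c)) = (next_half_edge G ^^ l) ?d"
    proof -
      have "(next_half_edge G ^^ m) c = next_half_edge G ((next_half_edge G ^^ l) ?d)"
        unfolding 3 by (simp add: funpow_swap1)
      moreover have "(next_half_edge G ^^ l) ?d \<in> corners G"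
        by (induction l) (use less.prems in auto)
      ultimately show ?thesis
        by (simp add: next_half_edge_def)
    qed
    moreover have "seg G (gap G (seg G c)) = seg G ?d"
      by (simp add: next_half_edge_def)
    moreover have "(next_half_edge G ^^ l) ?d \<noteq> seg G ?d"
      using less.IH[of l ?d] less.prems 3 by simp
    ultimately show ?thesis by metis
  qed
qed

lemma corner_at_neq_seg: "corner_at a \<noteq> seg G (corner_at b)"
proof
  assume eq: "corner_at a = seg G (corner_at b)"
  show False
  proof (cases "b \<le> a")
    case True
    then show False
      using eq funpow_next_neq_seg[of "corner_at b" "a - b"] by (simp add: funpow_next_corner_at)
  next
    case False
    moreover have "seg G (corner_at a) = corner_at b"
      using eq by simp
    ultimately show False
      using funpow_next_neq_seg[of "corner_at a" "b - a"] by (simp add: funpow_next_corner_at)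
  qed
qed

lemma ex_period: "\<exists>n>0. corner_at n = base"
proof -
  have "\<not> inj corner_at"
    using finite_subset[of "range corner_at" "corners G"] finite_corners finite_imageD[of corner_at UNIV]
      image_subsetI[of UNIV corner_at "corners G"] by auto
  then obtain a b where "a < b" "corner_at a = corner_at b"
    by (metis injI linorder_neqE_nat)
  then have "corner_at (0 + a) = corner_at ((b - a) + a)"
    by simp
  then show ?thesis
    using corner_at_cancel[of 0 a "b - a"] \<open>a < b\<close> by (auto simp: corner_at_0 intro: exI[of _ "b - a"])
qed

text \<open>
  The corners of the two forms are permuted by \<open>seg\<close> and \<open>gap\<close>, and the boundary of the only vertex-disc
  is a single circle.
\<close>

lemma corner_cases:
  assumes "c \<in> corners G"
  obtains (pos) k where "c = corner_at k" | (neg) k where "c = seg G (corner_at k)"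
proof -
  let ?S = "range corner_at \<union> seg G ` range corner_at"
  obtain v where v: "vdiscs G = {v}"
    using one_disc by (auto simp: card_1_singleton_iff)
  have disc: "disc_of G c = disc_of G base"
    using disc_of_in[OF assms] disc_of_in[OF base_in] v by simp
  obtain n where n: "n > 0" "corner_at n = base"
    using ex_period by auto
  have "gap G (corner_at k) \<in> ?S" for k
  proof (cases k)
    case 0
    then show ?thesis
      using n gap_corner_at_Suc[of "n - 1"] by (auto simp: corner_at_0)
  qed (auto simp: gap_corner_at_Suc)
  moreover have "gap G (seg G (corner_at k)) \<in> ?S" for k
    by (auto simp: corner_at_Suc[symmetric])
  ultimately have closed: "seg G x \<in> ?S \<and> gap G x \<in> ?S" if "x \<in> ?S" for x
    using that by auto
  have "c \<in> ?S"
    by (rule curve_rel_least[OF disc_boundary[OF base_in assms disc[symmetric]]])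
       (use closed corner_at_0 rangeI[of corner_at 0] in auto)
  then show thesis
    using that by blast
qed

lemma least_return_time:
  assumes n: "n > 0" "corner_at n = base" and least: "\<And>m. 0 < m \<Longrightarrow> m < n \<Longrightarrow> corner_at m \<noteq> base"
  shows "inj_on corner_at {..<n}" "corner_at (k + n) = corner_at k" "corner_at (k mod n) = corner_at k"
proof -
  have False if "a < b" "b < n" "corner_at a = corner_at b" for a b
  proof -
    have "corner_at (0 + a) = corner_at ((b - a) + a)"
      using that by simp
    then have "corner_at (b - a) = base"
      using corner_at_cancel[of 0 a "b - a"] by (simp add: corner_at_0)
    then show False
      using least[of "b - a"] that by auto
  qed
  then show "inj_on corner_at {..<n}"
    by (intro inj_onI) (metis lessThan_iff linorder_neqE_nat)
  have *: "corner_at (k + n) = corner_at k" for k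
    using n(2) by (simp add: funpow_next_corner_at[of k n, symmetric]) (simp add: corner_at_def)
  then show "corner_at (k + n) = corner_at k" .
  have "corner_at (r + q * n) = corner_at r" for q r
  proof (induction q)
    case (Suc q)
    then show ?case using *[of "r + q * n"] by (simp add: algebra_simps)
  qed simp
  from this[of "k mod n" "k div n"] show "corner_at (k mod n) = corner_at k"
    by simp
qed

text \<open>
  The common source of the two counts needed of the walk: its period is the number of all half-edges
  (take everything for \<open>R\<close>), and every ribbon is met twice (take a singleton).
\<close>

lemma segments_by_position:
  assumes n: "\<And>k. corner_at (k mod n) = corner_at k" "n > 0"
  shows "{{c, seg G c} |c. c \<in> corners G \<and> ribbon_of G c \<in> R} =
    (\<lambda>k. {corner_at k, seg G (corner_at k)}) ` {k. k < n \<and> word k \<in> R}" (is "?L = ?F ` ?K")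
proof (intro equalityI subsetI)
  fix h assume "h \<in> ?L"
  then obtain c where c: "c \<in> corners G" "ribbon_of G c \<in> R" "h = {c, seg G c}"
    by auto
  from c(1) obtain k where "h = {corner_at k, seg G (corner_at k)}" "word k \<in> R"
    by (cases rule: corner_cases) (use c in \<open>auto simp: word_def insert_commute\<close>)
  then have "h = ?F (k mod n)" "k mod n \<in> ?K"
    using n by (auto simp: word_def)
  then show "h \<in> ?F ` ?K" by blast
qed (auto simp: word_def)

lemma inj_on_segments:
  assumes "inj_on corner_at {..<n}"
  shows "inj_on (\<lambda>k. {corner_at k, seg G (corner_at k)}) {..<n}"
  using assms corner_at_neq_seg by (auto simp: inj_on_def doubleton_eq_iff)

lemma period_facts:
  shows inj_on_corner_at: "inj_on corner_at {..<period}"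
    and corner_at_period: "corner_at (k + period) = corner_at k"
    and corner_at_mod: "corner_at (k mod period) = corner_at k"
    and period_pos: "period > 0"
proof -
  define n where "n = (LEAST n. n > 0 \<and> corner_at n = base)"
  have n: "n > 0" "corner_at n = base"
    using LeastI_ex[OF ex_period] by (auto simp: n_def)
  have least: "corner_at m \<noteq> base" if "0 < m" "m < n" for m
    using that not_less_Least[of m "\<lambda>n. n > 0 \<and> corner_at n = base"] by (auto simp: n_def)
  note u = least_return_time[OF n least]
  have "half_edges G = (\<lambda>k. {corner_at k, seg G (corner_at k)}) ` {..<n}"
    using segments_by_position[OF u(3) n(1), of UNIV] by (auto simp: half_edges_def lessThan_def)
  then have "period = n"
    using card_image[OF inj_on_segments[OF u(1)]] by simp
  with u n show "inj_on corner_at {..<period}" "corner_at (k + period) = corner_at k"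
    "corner_at (k mod period) = corner_at k" "period > 0"
    by simp_all
qed

lemma word_period: "word (k + period) = word k" "word (k mod period) = word k"
  by (simp_all add: word_def corner_at_period corner_at_mod)

lemma word_in [simp]: "word k \<in> ribbons G"
  by (simp add: word_def)

lemma card_positions:
  assumes "e \<in> ribbons G"
  shows "card {k. k < period \<and> word k = e} = 2"
proof -
  let ?F = "\<lambda>k. {corner_at k, seg G (corner_at k)}"
  have "inj_on ?F {k. k < period \<and> word k = e}"
    by (rule inj_on_subset[OF inj_on_segments[OF inj_on_corner_at]]) auto
  from card_image[OF this] show ?thesis
    using two_segments[OF assms] segments_by_position[OF corner_at_mod period_pos, of "{e}"] by simp
qed

lemma positions:
  assumes "e \<in> ribbons G"
  obtains p q where "p < q" "q < period" "{k. k < period \<and> word k = e} = {p, q}"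
proof -
  obtain p q where pq: "{k. k < period \<and> word k = e} = {p, q}" "p \<noteq> q"
    using card_positions[OF assms] by (auto simp: card_2_iff)
  then have "p < period" "q < period" by auto
  with pq that[of p q] that[of q p] show thesis
    by (cases "p < q") (auto simp: insert_commute)
qed

lemma word_at_positions:
  assumes "{k. k < period \<and> word k = e} = {p, q}"
  shows "word p = e" "word q = e"
proof -
  have "p \<in> {k. k < period \<and> word k = e}" "q \<in> {k. k < period \<and> word k = e}"
    unfolding assms by simp_all
  then show "word p = e" "word q = e"
    by simp_all
qed

section \<open>Interlacement counted between the two occurrences of a ribbon\<close>

lemma funpow_next_seg:
  "m \<le> k \<Longrightarrow> (next_half_edge G ^^ m) (seg G (corner_at k)) = seg G (corner_at (k - m))"
proof (induction m)
  case (Suc m)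
  then have "k - m = Suc (k - Suc m)" by simp
  with Suc show ?case
    by (simp add: next_half_edge_def gap_corner_at_Suc)
qed simp

text \<open>
  The definition of interlacement starts at any corner, hence may read the word in either direction.
  An alternating pattern that is read backwards is also alternating when read forwards.
\<close>

lemma interlaced_imp_alternating:
  assumes "interlaced G e f"
  obtains x\<^sub>0 x\<^sub>1 x\<^sub>2 x\<^sub>3 where "x\<^sub>0 < period" "x\<^sub>0 < x\<^sub>1" "x\<^sub>1 < x\<^sub>2" "x\<^sub>2 < x\<^sub>3" "x\<^sub>3 < x\<^sub>0 + period"
    "word x\<^sub>0 = e" "word x\<^sub>1 = f" "word x\<^sub>2 = e" "word x\<^sub>3 = f"
proof -
  note result = that
  have shift: thesis if "x\<^sub>0 < x\<^sub>1" "x\<^sub>1 < x\<^sub>2" "x\<^sub>2 < x\<^sub>3" "x\<^sub>3 < x\<^sub>0 + period"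
    "word x\<^sub>0 = e" "word x\<^sub>1 = f" "word x\<^sub>2 = e" "word x\<^sub>3 = f" for x\<^sub>0 x\<^sub>1 x\<^sub>2 x\<^sub>3
  proof -
    define m where "m = period * (x\<^sub>0 div period)"
    have m: "m \<le> x\<^sub>0" by (simp add: m_def)
    have "word (y - m) = word y" if "x\<^sub>0 \<le> y" for y
    proof -
      have "y - m + m = y"
        using that m by linarith
      then have "(y - m) mod period = y mod period"
        by (metis m_def mod_mult_self2)
      then show ?thesis
        by (metis word_period(2))
    qed
    moreover have "x\<^sub>0 - m < period"
      using period_pos by (simp add: m_def minus_mult_div_eq_mod)
    ultimately show thesis
      using that m
      by (intro result[of "x\<^sub>0 - m" "x\<^sub>1 - m" "x\<^sub>2 - m" "x\<^sub>3 - m"]) simp_all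
  qed
  obtain c a b d where c: "c \<in> corners G" and less: "0 < a" "a < b" "b < d" "d < period"
    and rib: "ribbon_of G c = e" "ribbon_of G ((next_half_edge G ^^ a) c) = f"
      "ribbon_of G ((next_half_edge G ^^ b) c) = e" "ribbon_of G ((next_half_edge G ^^ d) c) = f"
    using assms unfolding interlaced_def by blast
  from c show thesis
  proof (cases rule: corner_cases)
    case (pos s)
    have "ribbon_of G ((next_half_edge G ^^ m) c) = word (m + s)" for m
      by (simp add: pos funpow_next_corner_at word_def)
    then show thesis
      using less rib by (intro shift[of s "a + s" "b + s" "d + s"]) (simp_all add: pos word_def)
  next
    case (neg s)
    \<comment> \<open>Walking from \<open>seg (corner_at s)\<close> reads the word downwards; one period is added so that positions stay
      nonnegative.\<close>
    have backwards: "ribbon_of G ((next_half_edge G ^^ m) c) = word (s + period - m)" if "m < period" for m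
      using that funpow_next_seg[of m "s + period"] by (simp add: neg word_def corner_at_period)
    have "word (s + period) = e" "word (s + period - a) = f" "word (s + period - b) = e"
      "word (s + period - d) = f"
      using backwards[of 0] backwards[of a] backwards[of b] backwards[of d] less rib by simp_all
    moreover have "word (s + period - d + period) = word (s + period - d)"
      by (rule word_period)
    \<comment> \<open>In increasing order the letters read are \<open>f e f e\<close>; moving the first one up by a period gives \<open>e f e f\<close>.\<close>
    ultimately show thesis
      using less by (intro shift[of "s + period - b" "s + period - a" "s + period" "s + period - d + period"]) simp_all
  qed
qed

text \<open>
  The parity makes interlacement accessible to \<open>GF(2)\<close>-counting: there is one occurrence of \<open>f\<close> in between
  if the ribbons are interlaced, and there are none or two otherwise.
\<close>

lemma interlaced_iff_one_between:
  assumes e: "e \<in> ribbons G" and f: "f \<in> ribbons G"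
    and pq: "p < q" "q < period" "{k. k < period \<and> word k = e} = {p, q}"
  shows "interlaced G e f \<longleftrightarrow> odd (card {k. p < k \<and> k < q \<and> word k = f})"
proof (cases "e = f")
  case True
  have "{k. p < k \<and> k < q \<and> word k = e} = {}"
  proof -
    have "k \<in> {p, q}" if "k < q" "word k = e" for k
      using that pq(2,3) order_less_trans by blast
    then show ?thesis by fastforce
  qed
  then show ?thesis
    using True by (metis card.empty even_zero interlaced_def)
next
  case False
  have at_e: "word k = e \<longleftrightarrow> k = p \<or> k = q" if "k < period" for k
    using that pq(3) by blast
  obtain u v where uv: "u < v" "v < period" "{k. k < period \<and> word k = f} = {u, v}"
    using positions[OF f] .
  have at_f: "word k = f \<longleftrightarrow> k = u \<or> k = v" if "k < period" for k
    using that uv(3) by blast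
  have distinct: "u \<noteq> p" "u \<noteq> q" "v \<noteq> p" "v \<noteq> q"
    using False at_e at_f pq uv by (metis order_less_trans)+
  have "{k. p < k \<and> k < q \<and> word k = f} = {u, v} \<inter> {p<..<q}"
  proof (intro equalityI subsetI)
    fix k assume "k \<in> {k. p < k \<and> k < q \<and> word k = f}"
    then show "k \<in> {u, v} \<inter> {p<..<q}"
      using at_f[of k] pq(2) by auto
  next
    fix k assume "k \<in> {u, v} \<inter> {p<..<q}"
    then show "k \<in> {k. p < k \<and> k < q \<and> word k = f}"
      using at_f[of k] pq(2) by auto
  qed
  moreover have "odd (card ({u, v} \<inter> {p<..<q})) \<longleftrightarrow> (p < u \<and> u < q) \<noteq> (p < v \<and> v < q)"
    using uv(1) by (cases "p < u \<and> u < q"; cases "p < v \<and> v < q") (auto simp: Int_insert_left)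
  ultimately have card: "odd (card {k. p < k \<and> k < q \<and> word k = f}) \<longleftrightarrow>
      (p < u \<and> u < q) \<noteq> (p < v \<and> v < q)"
    by simp
  have "(p < u \<and> u < q) \<noteq> (p < v \<and> v < q)" if alternating: "interlaced G e f"
  proof -
    obtain x\<^sub>0 x\<^sub>1 x\<^sub>2 x\<^sub>3 where x: "x\<^sub>0 < period" "x\<^sub>0 < x\<^sub>1" "x\<^sub>1 < x\<^sub>2" "x\<^sub>2 < x\<^sub>3" "x\<^sub>3 < x\<^sub>0 + period"
      and w: "word x\<^sub>0 = e" "word x\<^sub>1 = f" "word x\<^sub>2 = e" "word x\<^sub>3 = f"
      using interlaced_imp_alternating[OF alternating] .
    have reduce: "x \<in> A \<union> (\<lambda>k. k + period) ` A" if "x < 2 * period" "word x = g" "{k. k < period \<and> word k = g} = A"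
      for x g A
    proof (cases "x < period")
      case False
      then have "word (x - period) = g" "x - period < period"
        using that word_period(1)[of "x - period"] by simp_all
      then have "x - period \<in> A"
        using that by blast
      then show ?thesis
        using False by (auto intro: image_eqI[of _ _ "x - period"])
    qed (use that in auto)
    show ?thesis
    proof (rule separated_if_alternating[OF x(2-) pq(1,2) uv(1,2)])
      show "x\<^sub>0 \<in> {p, q}"
        using x(1) w(1) pq(3) by blast
      show "x\<^sub>2 \<in> {p, q, p + period, q + period}"
        using reduce[OF _ w(3) pq(3)] x by auto
      show "x\<^sub>1 \<in> {u, v, u + period, v + period}"
        using reduce[OF _ w(2) uv(3)] x by auto
      show "x\<^sub>3 \<in> {u, v, u + period, v + period}"
        using reduce[OF _ w(4) uv(3)] x by auto
    qed
  qed
  moreover have "interlaced G e f" if separated: "(p < u \<and> u < q) \<noteq> (p < v \<and> v < q)"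
  proof -
    \<comment> \<open>Read from \<open>p\<close> on: \<open>y\<close> is the occurrence of \<open>f\<close> before \<open>q\<close>, and \<open>z\<close> the one after \<open>q\<close>, possibly after
      passing the end of the period; \<open>d\<close> is the distance from \<open>p\<close> to \<open>z\<close>.\<close>
    obtain y z where y: "y \<in> {u, v}" "p < y" "y < q" and z: "z \<in> {u, v}" "\<not> (p < z \<and> z < q)"
    proof (cases "p < u \<and> u < q")
      case True
      then show thesis using that[of u v] separated by simp
    next
      case False
      then show thesis using that[of v u] separated False by auto
    qed
    have "u < period"
      using uv(1,2) by simp
    then have "word u = f" "word v = f"
      using at_f uv(2) by simp_all
    then have y_word: "word y = f" and z_word: "word z = f" and z_less: "z < period"
      using y(1) z(1) uv(2) \<open>u < period\<close> by auto
    have z_neq: "z \<noteq> p" "z \<noteq> q"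
      using z(1) distinct by auto
    define d where "d = (if z < p then z + period - p else z - p)"
    have "d + p = z \<or> d + p = z + period"
      using pq(1,2) by (simp add: d_def)
    then have "word (d + p) = f"
      using z_word word_period(1)[of z] by metis
    moreover have "q - p < d" "d < period"
      using z(2) z_neq z_less pq(1,2) unfolding d_def by (cases "z < p"; simp)+
    moreover have "word p = e" "word q = e"
      using at_e pq(1,2) by simp_all
    ultimately show ?thesis
      unfolding interlaced_def using False y(2,3) y_word pq(1)
      by (intro conjI bexI[of _ "corner_at p"] exI[of _ "y - p"] exI[of _ "q - p"] exI[of _ d])
         (simp_all add: funpow_next_corner_at word_def)
  qed
  ultimately show ?thesis
    using card by blast
qed

section \<open>Unions of faces and the kernel of the interlace matrix\<close>

text \<open>
  A side of a twisted ribbon joins two corners at which half-edges are entered; a side of an untwisted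
  ribbon leads from such a corner to one at which a half-edge is left.
\<close>

definition twisted :: "'e \<Rightarrow> bool" where
  "twisted e \<longleftrightarrow> (\<exists>k. word k = e \<and> side G (corner_at k) \<in> range corner_at)"

lemma side_of_first_end:
  assumes pq: "p < q" "q < period" "{k. k < period \<and> word k = e} = {p, q}"
  shows "side G (corner_at p) = (if twisted e then corner_at q else seg G (corner_at q))"
proof -
  have mod_pos: "k mod period = p \<or> k mod period = q" if "word k = e" for k
  proof -
    have "k mod period \<in> {k. k < period \<and> word k = e}"
      using that period_pos by (simp add: word_period)
    then show ?thesis using pq(3) by blast
  qed
  have corner_pos: "corner_at k = corner_at p \<or> corner_at k = corner_at q" if "word k = e" for k
    using mod_pos[OF that] corner_at_mod by metis
  have word_p: "word p = e"
    by (rule word_at_positions(1)[OF pq(3)])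
  have rib: "ribbon_of G (side G (corner_at p)) = e"
    using word_p by (simp add: word_def)
  have "side G (corner_at p) \<in> corners G"
    by simp
  then show ?thesis
  proof (cases rule: corner_cases)
    case (pos k)
    then have "twisted e"
      using word_p by (auto simp: twisted_def)
    moreover have "corner_at k = corner_at p \<or> corner_at k = corner_at q"
      using corner_pos rib pos by (simp add: word_def)
    ultimately show ?thesis
      using pos side_simps(2)[of "corner_at p"] by auto
  next
    case (neg k)
    then have "corner_at k = corner_at p \<or> corner_at k = corner_at q"
      using corner_pos rib by (simp add: word_def)
    then have side_p: "side G (corner_at p) = seg G (corner_at q)"
      using neg side_neq_seg[of "corner_at p"] by auto
    have side_q: "side G (corner_at q) = seg G (corner_at p)"
      using arg_cong[OF side_p, of "side G"] side_seg[of "corner_at q"] seg_simps(3)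
      by (metis corner_at_in side_simps(1,3))
    have "\<not> twisted e"
    proof
      assume "twisted e"
      then obtain l m where "word l = e" "side G (corner_at l) = corner_at m"
        unfolding twisted_def by blast
      then show False
        using corner_pos[of l] side_p side_q corner_at_neq_seg by metis
    qed
    then show ?thesis
      using side_p by simp
  qed
qed

text \<open>
  The colour of \<open>corner_at k\<close>, if the walk starts with colour \<open>a\<close> and changes its colour across the
  segments of the ribbons in \<open>X\<close>.  As the colour is constant along free arcs, \<open>colour X a (Suc k)\<close> is also the
  colour of \<open>seg (corner_at k)\<close>.
\<close>

primrec colour :: "'e set \<Rightarrow> bool \<Rightarrow> nat \<Rightarrow> bool" where
  "colour X a 0 = a"
| "colour X a (Suc k) = (colour X a k \<noteq> (word k \<in> X))"

lemma colour_add: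
  "colour X a (k + m) = (colour X a k \<noteq> odd (card {j. k \<le> j \<and> j < k + m \<and> word j \<in> X}))"
proof (induction m)
  case (Suc m)
  have "{j. k \<le> j \<and> j < k + Suc m \<and> word j \<in> X} =
      {j. k \<le> j \<and> j < k + m \<and> word j \<in> X} \<union> (if word (k + m) \<in> X then {k + m} else {})"
    by (auto simp: less_Suc_eq)
  then have "card {j. k \<le> j \<and> j < k + Suc m \<and> word j \<in> X} =
      card {j. k \<le> j \<and> j < k + m \<and> word j \<in> X} + (if word (k + m) \<in> X then 1 else 0)"
    by simp
  with Suc show ?case
    by auto
next
  case 0
  have "{j. k \<le> j \<and> j < k \<and> word j \<in> X} = {}"
    by auto
  then show ?case
    by (simp only: add_0_right card.empty even_zero simp_thms)
qed

lemma card_positions_in: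
  assumes "finite I" "finite X"
  shows "card {j \<in> I. word j \<in> X} = (\<Sum>f\<in>X. card {j \<in> I. word j = f})"
proof -
  have "{j \<in> I. word j \<in> X} = (\<Union>f\<in>X. {j \<in> I. word j = f})"
    by auto
  then show ?thesis
    using card_UN_disjoint[of X "\<lambda>f. {j \<in> I. word j = f}"] assms by auto
qed

text \<open>
  Each ribbon of \<open>X\<close> is crossed twice in one turn.
\<close>

lemma colour_period:
  assumes "X \<subseteq> ribbons G"
  shows "colour X a (k + period) = colour X a k"
proof (induction k)
  case 0
  have "card {j. j < period \<and> word j \<in> X} = (\<Sum>f\<in>X. card {j. j < period \<and> word j = f})"
    using card_positions_in[of "{..<period}" X] finite_subset[OF assms finite_ribbons] by simp
  also have "\<dots> = 2 * card X"
    using card_positions assms by (simp add: subset_iff)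
  finally show ?case
    using colour_add[of X a 0 period] by simp
qed (simp add: word_period)

lemma colour_mod:
  assumes "X \<subseteq> ribbons G"
  shows "colour X a (k mod period) = colour X a k"
proof -
  have "colour X a (r + m * period) = colour X a r" for r m
  proof (induction m)
    case (Suc m)
    then show ?case
      using colour_period[OF assms, of a "r + m * period"] by (simp add: algebra_simps)
  qed simp
  from this[of "k mod period" "k div period"] show ?thesis
    by simp
qed

lemma colour_cong:
  assumes "X \<subseteq> ribbons G" "corner_at k = corner_at l"
  shows "colour X a k = colour X a l"
proof -
  have "corner_at (k mod period) = corner_at (l mod period)"
    using assms(2) by (simp add: corner_at_mod)
  then have "k mod period = l mod period"
    using inj_on_corner_at period_pos by (simp add: inj_on_def)
  then show ?thesis
    using colour_mod[OF assms(1)] by metis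
qed

definition colouring :: "'e set \<Rightarrow> bool \<Rightarrow> 'c set" where
  "colouring X a = {corner_at k |k. colour X a k} \<union> {seg G (corner_at k) |k. colour X a (Suc k)}"

lemma mem_colouring:
  assumes "X \<subseteq> ribbons G"
  shows "corner_at k \<in> colouring X a \<longleftrightarrow> colour X a k"
    and "seg G (corner_at k) \<in> colouring X a \<longleftrightarrow> colour X a (Suc k)"
proof -
  show "corner_at k \<in> colouring X a \<longleftrightarrow> colour X a k"
    using colour_cong[OF assms, of k] corner_at_neq_seg unfolding colouring_def by blast
  have "colour X a (Suc k) = colour X a (Suc l)" if "seg G (corner_at k) = seg G (corner_at l)" for l
  proof (rule colour_cong[OF assms])
    show "corner_at (Suc k) = corner_at (Suc l)"
      using that by (simp add: corner_at_Suc)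
  qed
  then show "seg G (corner_at k) \<in> colouring X a \<longleftrightarrow> colour X a (Suc k)"
    using corner_at_neq_seg[symmetric] unfolding colouring_def by blast
qed

lemma colouring_subset: "colouring X a \<subseteq> corners G"
  by (auto simp: colouring_def)

lemma corner_set_eqI:
  assumes "S \<subseteq> corners G" "T \<subseteq> corners G"
    and "\<And>k. corner_at k \<in> S \<longleftrightarrow> corner_at k \<in> T"
    and "\<And>k. seg G (corner_at k) \<in> S \<longleftrightarrow> seg G (corner_at k) \<in> T"
  shows "S = T"
proof -
  have "c \<in> S \<longleftrightarrow> c \<in> T" if "c \<in> corners G" for c
    using that by (cases rule: corner_cases) (use assms in auto)
  then show ?thesis
    using assms(1,2) by blast
qed

definition face_unions :: "'c set set" where
  "face_unions = {S. S \<subseteq> corners G \<and> (\<forall>c\<in>S. side G c \<in> S \<and> gap G c \<in> S)}"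

lemma card_face_unions: "card face_unions = 2 ^ card (faces G)"
proof -
  let ?r = "curve_rel (corners G) (side G) (gap G)"
  obtain v where v: "vdiscs G = {v}"
    using one_disc by (auto simp: card_1_singleton_iff)
  then have no_isolated: "vdiscs G - disc_of G ` corners G = {}"
    using disc_of_in[OF base_in] base_in by auto
  have "finite (corners G // ?r)"
    by (rule finite_quotient[OF finite_corners]) (auto simp: curve_rel_def)
  then have "card (faces G) = card (corners G // ?r)"
    unfolding faces_def no_isolated by (simp add: card_Plus)
  moreover have "face_unions = {S. S \<subseteq> corners G \<and> ?r `` S \<subseteq> S}"
    unfolding face_unions_def
  proof (intro Collect_cong conj_cong refl iffI subsetI)
    fix S d assume S: "\<forall>c\<in>S. side G c \<in> S \<and> gap G c \<in> S" and "d \<in> ?r `` S"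
    then obtain c where "(c, d) \<in> ?r" "c \<in> S" by blast
    then show "d \<in> S"
      by (rule curve_rel_least) (use S in blast)
  next
    fix S assume S: "S \<subseteq> corners G" "?r `` S \<subseteq> S"
    show "\<forall>c\<in>S. side G c \<in> S \<and> gap G c \<in> S"
      using S curve_rel_step[OF side_inv gap_inv] by blast
  qed
  ultimately show ?thesis
    using card_saturated_subsets[OF equiv_curve_rel[OF side_inv gap_inv] finite_corners] by simp
qed

text \<open>
  The kernel over \<open>GF(2)\<close> of the interlace matrix: the rows are the adjacency rows of the intersection
  graph, with diagonal entry \<open>1\<close> at the twisted ribbons; vectors are written as sets of ribbons.
\<close>

definition interlace_kernel :: "'e set set" where
  "interlace_kernel = {X. X \<subseteq> ribbons G \<and>
     (\<forall>e\<in>ribbons G. odd (card {f \<in> X. interlaced G e f}) \<longleftrightarrow> twisted e \<and> e \<in> X)}"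

lemma colour_second_end:
  assumes X: "X \<subseteq> ribbons G" and e: "e \<in> ribbons G"
    and pq: "p < q" "q < period" "{k. k < period \<and> word k = e} = {p, q}"
  shows "colour X a q \<longleftrightarrow> colour X a (Suc p) \<noteq> odd (card {f \<in> X. interlaced G e f})"
proof -
  have fin: "finite X"
    using X finite_ribbons finite_subset by blast
  have "card {j. p < j \<and> j < q \<and> word j \<in> X} = (\<Sum>f\<in>X. card {j. p < j \<and> j < q \<and> word j = f})"
    using card_positions_in[of "{p<..<q}" X] fin by simp
  then have "odd (card {j. p < j \<and> j < q \<and> word j \<in> X}) \<longleftrightarrow>
      odd (card {f \<in> X. odd (card {j. p < j \<and> j < q \<and> word j = f})})"
    using fin by (simp add: even_sum_iff)
  also have "{f \<in> X. odd (card {j. p < j \<and> j < q \<and> word j = f})} = {f \<in> X. interlaced G e f}"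
    using interlaced_iff_one_between[OF e _ pq] X by blast
  finally show ?thesis
    using colour_add[of X a "Suc p" "q - Suc p"] pq(1) by (simp add: Suc_le_eq del: colour.simps)
qed

text \<open>
  A colouring is constant along free arcs by construction.  By \<open>colour_second_end\<close> the condition of the
  kernel at \<open>e\<close> says that it is constant along the side at the first end of \<open>e\<close>.  The other side of \<open>e\<close> then
  follows, as crossing either segment of \<open>e\<close> has the same effect on the colour.
\<close>

lemma colouring_in_face_unions_iff:
  assumes X: "X \<subseteq> ribbons G"
  shows "colouring X a \<in> face_unions \<longleftrightarrow> X \<in> interlace_kernel"
proof -
  let ?S = "colouring X a"
  note mem = mem_colouring[OF X]
  have side_iff: "(corner_at p \<in> ?S \<longleftrightarrow> side G (corner_at p) \<in> ?S) \<longleftrightarrow>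
      (odd (card {f \<in> X. interlaced G e f}) \<longleftrightarrow> twisted e \<and> e \<in> X)"
    if "e \<in> ribbons G" "p < q" "q < period" "{k. k < period \<and> word k = e} = {p, q}" for e p q
  proof -
    have "word p = e" "word q = e"
      by (rule word_at_positions[OF that(4)])+
    then have "colour X a (Suc p) \<longleftrightarrow> colour X a p \<noteq> (e \<in> X)" "colour X a (Suc q) \<longleftrightarrow> colour X a q \<noteq> (e \<in> X)"
      by simp_all
    moreover have "side G (corner_at p) \<in> ?S \<longleftrightarrow> (if twisted e then colour X a q else colour X a (Suc q))"
      unfolding side_of_first_end[OF that(2-4)] by (simp only: mem if_split_mem1 split: if_split) simp
    ultimately show ?thesis
      using colour_second_end[OF X that, of a]
      by (cases "twisted e"; cases "e \<in> X") (simp_all only: mem simp_thms if_True if_False, argo+)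
  qed
  have gap_closed: "gap G c \<in> ?S" if "c \<in> ?S" for c
  proof -
    from that colouring_subset have "c \<in> corners G" by blast
    then show ?thesis
    proof (cases rule: corner_cases)
      case (pos k)
      have "corner_at k = corner_at (Suc (k + period - 1))"
        using period_pos by (simp add: corner_at_period)
      then obtain l where l: "c = corner_at (Suc l)"
        using pos by blast
      then show ?thesis
        using that unfolding l gap_corner_at_Suc mem by simp
    next
      case (neg k)
      then show ?thesis
        using that unfolding neg corner_at_Suc[symmetric] mem by simp
    qed
  qed
  show ?thesis
  proof
    assume S: "?S \<in> face_unions"
    have closed: "c \<in> ?S \<longleftrightarrow> side G c \<in> ?S" if "c \<in> corners G" for c
      using S side_simps(3)[OF that] unfolding face_unions_def
      by (metis (mono_tags, lifting) mem_Collect_eq)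
    have "odd (card {f \<in> X. interlaced G e f}) \<longleftrightarrow> twisted e \<and> e \<in> X" if e: "e \<in> ribbons G" for e
    proof -
      obtain p q where "p < q" "q < period" "{k. k < period \<and> word k = e} = {p, q}"
        using positions[OF e] .
      then show ?thesis
        using side_iff[OF e] closed[of "corner_at p"] by simp
    qed
    with X show "X \<in> interlace_kernel"
      by (simp add: interlace_kernel_def)
  next
    assume K: "X \<in> interlace_kernel"
    have "side G c \<in> ?S" if cS: "c \<in> ?S" for c
    proof -
      have c: "c \<in> corners G"
        using cS colouring_subset by blast
      define e where "e = ribbon_of G c"
      have e: "e \<in> ribbons G"
        using c by (simp add: e_def)
      obtain p q where pq: "p < q" "q < period" "{k. k < period \<and> word k = e} = {p, q}"
        using positions[OF e] .
      have words: "word p = e" "word q = e"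
        by (rule word_at_positions[OF pq(3)])+
      have pS: "corner_at p \<in> ?S \<longleftrightarrow> side G (corner_at p) \<in> ?S"
        using side_iff[OF e pq] K e by (auto simp: interlace_kernel_def)
      have flip: "seg G d \<in> ?S \<longleftrightarrow> (d \<in> ?S) \<noteq> (e \<in> X)" if "d \<in> {corner_at p, corner_at q}" for d
        using that words by (auto simp: mem)
      have flip': "seg G (side G (corner_at p)) \<in> ?S \<longleftrightarrow> (side G (corner_at p) \<in> ?S) \<noteq> (e \<in> X)"
        using flip[of "corner_at q"] side_of_first_end[OF pq] by auto
      have "c \<in> {corner_at p, seg G (corner_at p), side G (corner_at p), seg G (side G (corner_at p))}"
        by (rule ribbon_corners) (use c words in \<open>auto simp: e_def word_def\<close>)
      then show ?thesis
      proof (elim insertE emptyE)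
        assume c': "c = corner_at p"
        then show ?thesis using cS pS by simp
      next
        assume c': "c = seg G (corner_at p)"
        then have "side G c = seg G (side G (corner_at p))"
          by (simp add: side_seg)
        then show ?thesis using cS pS flip[of "corner_at p"] flip' unfolding c' by simp
      next
        assume c': "c = side G (corner_at p)"
        then show ?thesis using cS pS by simp
      next
        assume c': "c = seg G (side G (corner_at p))"
        then have "side G c = seg G (corner_at p)"
          by (simp add: side_seg)
        then show ?thesis using cS pS flip[of "corner_at p"] flip' unfolding c' by simp
      qed
    qed
    then show "?S \<in> face_unions"
      using gap_closed colouring_subset by (auto simp: face_unions_def)
  qed
qed

text \<open>
  Whether the colour changes across a segment is the same at both ends of a ribbon, since \<open>seg\<close> and
  \<open>side\<close> commute; \<open>X\<close> consists of the ribbons where it changes.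
\<close>

lemma face_union_is_colouring:
  assumes S: "S \<in> face_unions"
  obtains X where "X \<subseteq> ribbons G" "S = colouring X (base \<in> S)"
proof
  define X where "X = {word k |k. (corner_at k \<in> S) \<noteq> (seg G (corner_at k) \<in> S)}"
  show X: "X \<subseteq> ribbons G"
    by (auto simp: X_def)
  have S_sub: "S \<subseteq> corners G"
    using S by (simp add: face_unions_def)
  have side_closed: "c \<in> S \<longleftrightarrow> side G c \<in> S" and gap_closed: "c \<in> S \<longleftrightarrow> gap G c \<in> S"
    if "c \<in> corners G" for c
    using S side_simps(3)[OF that] gap_simps(3)[OF that] unfolding face_unions_def
    by (metis (mono_tags, lifting) mem_Collect_eq)+
  have jump_side: "((side G c \<in> S) \<noteq> (seg G (side G c) \<in> S)) = ((c \<in> S) \<noteq> (seg G c \<in> S))"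
    if "c \<in> corners G" for c
    using side_closed[OF that] side_closed[of "seg G c"] side_seg[OF that] seg_simps(1)[OF that] by metis
  have jump: "((corner_at k \<in> S) \<noteq> (seg G (corner_at k) \<in> S)) \<longleftrightarrow> word k \<in> X" for k
  proof
    assume "word k \<in> X"
    then obtain l where l: "ribbon_of G (corner_at k) = ribbon_of G (corner_at l)"
      "(corner_at l \<in> S) \<noteq> (seg G (corner_at l) \<in> S)"
      unfolding X_def word_def by auto
    have "corner_at k \<in> {corner_at l, seg G (corner_at l), side G (corner_at l), seg G (side G (corner_at l))}"
      using l(1) by (intro ribbon_corners) auto
    then show "(corner_at k \<in> S) \<noteq> (seg G (corner_at k) \<in> S)"
      using l(2) jump_side[of "corner_at l"] seg_simps(3) side_simps(1) corner_at_in
      by (metis insertE singletonD)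
  next
    assume "(corner_at k \<in> S) \<noteq> (seg G (corner_at k) \<in> S)"
    then show "word k \<in> X"
      unfolding X_def by blast
  qed
  have colour: "corner_at k \<in> S \<longleftrightarrow> colour X (base \<in> S) k" for k
  proof (induction k)
    case (Suc k)
    have "corner_at (Suc k) \<in> S \<longleftrightarrow> seg G (corner_at k) \<in> S"
      using gap_closed[of "seg G (corner_at k)"] by (simp add: corner_at_Suc)
    then show ?case
      using jump[of k] Suc unfolding colour.simps by metis
  qed (simp add: corner_at_0)
  show "S = colouring X (base \<in> S)"
    by (rule corner_set_eqI[OF S_sub colouring_subset])
       (use colour jump mem_colouring[OF X] in \<open>metis colour.simps(2)\<close>)+
qed

lemma inj_on_colouring: "inj_on (\<lambda>(X, a). colouring X a) (Pow (ribbons G) \<times> UNIV)"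
proof (rule inj_onI, clarify)
  fix X Y a b assume X: "X \<subseteq> ribbons G" and Y: "Y \<subseteq> ribbons G" and eq: "colouring X a = colouring Y b"
  have colour_eq: "colour X a k = colour Y b k" for k
    using eq mem_colouring(1)[OF X, of k a] mem_colouring(1)[OF Y, of k b] by simp
  have "word k \<in> X \<longleftrightarrow> word k \<in> Y" for k
    using colour_eq[of k] colour_eq[of "Suc k"] by auto
  moreover have "\<exists>k. e = word k" if "e \<in> ribbons G" for e
    using positions[OF that] by (metis (mono_tags, lifting) insertI1 mem_Collect_eq)
  ultimately have "X = Y"
    using X Y by blast
  then show "X = Y \<and> a = b"
    using colour_eq[of 0] by simp
qed

text \<open>
  This is the circuit-nullity formula: the number of faces exceeds the nullity of the interlace
  matrix by one.
\<close>

theorem two_power_faces: "2 ^ card (faces G) = 2 * card interlace_kernel"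
proof -
  have sub: "interlace_kernel \<subseteq> Pow (ribbons G)"
    by (auto simp: interlace_kernel_def)
  have "face_unions = (\<lambda>(X, a). colouring X a) ` (interlace_kernel \<times> UNIV)"
  proof (intro equalityI subsetI)
    fix S assume S: "S \<in> face_unions"
    obtain X where X: "X \<subseteq> ribbons G" "S = colouring X (base \<in> S)"
      using face_union_is_colouring[OF S] .
    then have "X \<in> interlace_kernel"
      using S colouring_in_face_unions_iff[OF X(1)] by metis
    then show "S \<in> (\<lambda>(X, a). colouring X a) ` (interlace_kernel \<times> UNIV)"
      using X(2) by (intro image_eqI[of _ _ "(X, base \<in> S)"]) auto
  qed (use colouring_in_face_unions_iff sub in auto)
  moreover have "inj_on (\<lambda>(X, a). colouring X a) (interlace_kernel \<times> UNIV)"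
    by (rule inj_on_subset[OF inj_on_colouring]) (use sub in auto)
  ultimately have "card face_unions = card (interlace_kernel \<times> (UNIV :: bool set))"
    by (simp add: card_image)
  then show ?thesis
    by (simp add: card_face_unions card_cartesian_product)
qed

end

section \<open>The interlace matrix of a star\<close>

lemma card_even_subsets:
  assumes "finite A" "A \<noteq> {}"
  shows "2 * card {X. X \<subseteq> A \<and> even (card X)} = 2 ^ card A"
proof -
  obtain a where a: "a \<in> A"
    using assms(2) by blast
  define toggle where "toggle X = (if a \<in> X then X - {a} else insert a X)" for X
  have invol: "toggle (toggle X) = X" for X
    by (auto simp: toggle_def)
  have toggle: "toggle X \<subseteq> A" "even (card (toggle X)) \<longleftrightarrow> odd (card X)" if "X \<subseteq> A" for X
  proof -
    show "toggle X \<subseteq> A"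
      using that a by (auto simp: toggle_def)
    have "finite X"
      using that assms(1) finite_subset by blast
    then show "even (card (toggle X)) \<longleftrightarrow> odd (card X)"
      using card_Suc_Diff1[of X a] by (cases "a \<in> X") (auto simp: toggle_def simp flip: even_Suc)
  qed
  have "bij_betw toggle {X. X \<subseteq> A \<and> even (card X)} {X. X \<subseteq> A \<and> odd (card X)}"
    by (rule bij_betw_byWitness[where f' = toggle]) (use invol toggle in auto)
  then have "card {X. X \<subseteq> A \<and> even (card X)} = card {X. X \<subseteq> A \<and> odd (card X)}"
    by (rule bij_betw_same_card)
  moreover have "card (Pow A) = card {X. X \<subseteq> A \<and> even (card X)} + card {X. X \<subseteq> A \<and> odd (card X)}"
    using assms(1) by (subst card_Un_disjoint[symmetric]) (auto intro!: arg_cong[where f = card])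
  ultimately show ?thesis
    using card_Pow[OF assms(1)] by simp
qed

lemma sum_monom_card_subsets:
  assumes "finite A"
  shows "(\<Sum>X\<in>Pow A. monom (1::int) (card X)) = (1 + [:0, 1:]) ^ card A"
proof -
  have "(1 + [:0, 1::int:]) ^ card A = (\<Prod>x\<in>A. [:0, 1:] + 1)"
    by (simp add: add.commute)
  also have "\<dots> = (\<Sum>X\<in>Pow A. [:0, 1:] ^ card X)"
    unfolding prod_add[OF assms] by simp
  also have "\<dots> = (\<Sum>X\<in>Pow A. monom 1 (card X))"
    by (simp add: monom_altdef)
  finally show ?thesis ..
qed

text \<open>
  The kernel over \<open>GF(2)\<close> of the adjacency matrix of the star with hub \<open>h\<close> and set of leaves \<open>L\<close>, with
  diagonal entries \<open>1\<close> at the vertices in \<open>D\<close>.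
\<close>

definition star_kernel :: "'e set \<Rightarrow> 'e \<Rightarrow> 'e set \<Rightarrow> 'e set set" where
  "star_kernel L h D = {X. X \<subseteq> insert h L \<and>
     (\<forall>e\<in>insert h L. odd (card {f \<in> X. e = h \<and> f \<in> L \<or> e \<in> L \<and> f = h}) \<longleftrightarrow> e \<in> D \<and> e \<in> X)}"

lemma mem_star_kernel:
  assumes "h \<notin> L"
  shows "X \<in> star_kernel L h D \<longleftrightarrow> X \<subseteq> insert h L \<and> (odd (card (X \<inter> L)) \<longleftrightarrow> h \<in> D \<and> h \<in> X) \<and>
    (\<forall>e\<in>L. h \<in> X \<longleftrightarrow> e \<in> D \<and> e \<in> X)"
proof -
  have "{f \<in> X. e = h \<and> f \<in> L \<or> e \<in> L \<and> f = h} = (if h \<in> X then {h} else {})" if "e \<in> L" for e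
    using that assms by auto
  then have "odd (card {f \<in> X. e = h \<and> f \<in> L \<or> e \<in> L \<and> f = h}) \<longleftrightarrow> h \<in> X" if "e \<in> L" for e
    using that by simp
  moreover have "{f \<in> X. h = h \<and> f \<in> L \<or> h \<in> L \<and> f = h} = X \<inter> L"
    using assms by auto
  ultimately show ?thesis
    by (auto simp: star_kernel_def)
qed

text \<open>
  The row of a leaf outside \<open>D\<close> excludes the hub from \<open>X\<close>, then the rows of the leaves in \<open>D\<close> exclude
  these, and the row of the hub requires an even number of the remaining leaves.
\<close>

lemma card_star_kernel_untwisted_leaf:
  assumes L: "finite L" "h \<notin> L" and D: "\<not> L \<subseteq> D"
  shows "2 * card (star_kernel L h D) = 2 ^ (card L - card (L \<inter> D))"
proof -
  have "X \<in> star_kernel L h D \<longleftrightarrow> X \<subseteq> L - D \<and> even (card X)" for X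
  proof
    assume X: "X \<in> star_kernel L h D"
    then have h: "h \<notin> X"
      using D mem_star_kernel[OF L(2)] by blast
    then have "X \<subseteq> L - D"
      using X mem_star_kernel[OF L(2)] by blast
    moreover from this have "X \<inter> L = X" by blast
    ultimately show "X \<subseteq> L - D \<and> even (card X)"
      using X h mem_star_kernel[OF L(2), of X D] by simp
  next
    assume X: "X \<subseteq> L - D \<and> even (card X)"
    then have "X \<inter> L = X" by blast
    then show "X \<in> star_kernel L h D"
      using X L(2) mem_star_kernel[OF L(2), of X D] by auto
  qed
  then have "star_kernel L h D = {X. X \<subseteq> L - D \<and> even (card X)}"
    by blast
  moreover have "card (L - D) = card L - card (L \<inter> D)"
    using L(1) by (simp add: card_Diff_subset_Int)
  ultimately show ?thesis
    using card_even_subsets[of "L - D"] L(1) D by auto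
qed

text \<open>
  The rows of the leaves force all vertices to be in \<open>X\<close> or all to be outside; the row of the hub
  decides whether the full set is allowed.
\<close>

lemma card_star_kernel_twisted_leaves:
  assumes L: "finite L" "h \<notin> L" "L \<noteq> {}" and D: "L \<subseteq> D"
  shows "card (star_kernel L h D) = (if odd (card L) = (h \<in> D) then 2 else 1)"
proof -
  have "X \<in> star_kernel L h D \<longleftrightarrow> X = {} \<or> X = insert h L \<and> odd (card L) = (h \<in> D)" for X
  proof (cases "h \<in> X")
    case True
    have "X \<in> star_kernel L h D \<Longrightarrow> X = insert h L"
      using True mem_star_kernel[OF L(2), of X D] by blast
    moreover have "insert h L \<inter> L = L"
      by blast
    ultimately show ?thesis
      using True D mem_star_kernel[OF L(2), of X D] by auto
  next
    case False
    have "X \<in> star_kernel L h D \<Longrightarrow> X = {}"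
      using False D mem_star_kernel[OF L(2), of X D] by blast
    then show ?thesis
      using False mem_star_kernel[OF L(2), of X D] by auto
  qed
  then have "star_kernel L h D = (if odd (card L) = (h \<in> D) then {{}, insert h L} else {{}})"
    by (auto simp: set_eq_iff[of "star_kernel L h D"])
  then show ?thesis
    by simp
qed

lemma num_components_one_disc:
  assumes "vdiscs G = {v}"
  shows "num_components G = 1"
proof -
  let ?U = "underlying_graph G"
  have "x \<rightarrow>\<^sup>*\<^bsub>?U\<^esub> y \<longleftrightarrow> x = v \<and> y = v" for x y
  proof
    assume "x \<rightarrow>\<^sup>*\<^bsub>?U\<^esub> y"
    then have "x \<in> verts ?U" "y \<in> verts ?U"
      by (auto elim: reachable_in_vertsE)
    with assms show "x = v \<and> y = v"
      by (simp add: underlying_graph_def)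
  next
    assume "x = v \<and> y = v"
    then show "x \<rightarrow>\<^sup>*\<^bsub>?U\<^esub> y"
      using assms by (simp add: reachable_def underlying_graph_def)
  qed
  then have "pre_digraph.sccs_verts ?U = {{v}}"
    unfolding pre_digraph.sccs_verts_def by auto
  then show ?thesis
    by (simp add: num_components_def)
qed

text \<open>
  The rank over \<open>GF(2)\<close> of the matrix whose kernel is \<open>star_kernel L h D\<close>.
\<close>

definition star_rank :: "'e set \<Rightarrow> 'e \<Rightarrow> 'e set \<Rightarrow> nat" where
  "star_rank L h D = (if L \<subseteq> D then card L + of_bool (odd (card L) \<noteq> (h \<in> D)) else 2 + card (L \<inter> D))"

text \<open>
  The rank-nullity theorem for this matrix, whose nullity is \<open>F - 1\<close> and whose size is \<open>card L + 1\<close>.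
\<close>

lemma star_rank_nullity:
  assumes L: "finite L" "h \<notin> L" "L \<noteq> {}" and F: "2 ^ F = 2 * card (star_kernel L h D)"
  shows "star_rank L h D + F = card L + 2"
proof (cases "L \<subseteq> D")
  case True
  then have "(2::nat) ^ F = 2 ^ (if odd (card L) = (h \<in> D) then 2 else 1)"
    using F card_star_kernel_twisted_leaves[OF L True] by simp
  then have "F = (if odd (card L) = (h \<in> D) then 2 else 1)"
    by (simp only: power_inject_exp one_less_numeral_iff semiring_norm)
  then show ?thesis
    using True by (auto simp: star_rank_def)
next
  case False
  have "F = card L - card (L \<inter> D)"
    using F card_star_kernel_untwisted_leaf[OF L(1,2) False] by simp
  moreover have "card (L \<inter> D) \<le> card L"
    using L(1) by (simp add: card_mono)
  ultimately show ?thesis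
    using False by (simp add: star_rank_def)
qed

text \<open>
  For \<open>D \<inter> L \<noteq> L\<close> the rank is independent of the hub; for \<open>D \<inter> L = L\<close> the two choices for the hub give the
  two ranks \<open>card L\<close> and \<open>card L + 1\<close>.
\<close>

lemma sum_monom_star_rank:
  assumes L: "finite L" "h \<notin> L"
  shows "(\<Sum>D\<in>Pow (insert h L). monom (1::int) (star_rank L h D)) =
    [:0, 1:] ^ card L + [:0, 1:] ^ (card L + 1) + 2 * [:0, 1:] ^ 2 * ((1 + [:0, 1:]) ^ card L - [:0, 1:] ^ card L)"
proof -
  let ?m = "\<lambda>D. monom (1::int) (star_rank L h D)"
  have "(\<Sum>D\<in>Pow (insert h L). ?m D) = (\<Sum>D\<in>Pow L. ?m D) + (\<Sum>D\<in>insert h ` Pow L. ?m D)"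
    unfolding Pow_insert by (rule sum.union_disjoint) (use L in auto)
  also have "(\<Sum>D\<in>insert h ` Pow L. ?m D) = (\<Sum>D\<in>Pow L. ?m (insert h D))"
    by (rule sum.reindex_cong[of "insert h"]) (use L(2) in \<open>auto intro!: inj_onI\<close>)
  also have "(\<Sum>D\<in>Pow L. ?m D) + (\<Sum>D\<in>Pow L. ?m (insert h D)) = (\<Sum>D\<in>Pow L. ?m D + ?m (insert h D))"
    by (simp add: sum.distrib)
  also have "\<dots> = (?m L + ?m (insert h L)) + (\<Sum>D\<in>Pow L - {L}. ?m D + ?m (insert h D))"
    using L(1) by (intro sum.remove) auto
  also have "?m L + ?m (insert h L) = [:0, 1:] ^ card L + [:0, 1:] ^ (card L + 1)"
    using L(2) by (auto simp: star_rank_def monom_altdef subset_insertI)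
  also have "(\<Sum>D\<in>Pow L - {L}. ?m D + ?m (insert h D)) = (\<Sum>D\<in>Pow L - {L}. 2 * [:0, 1:] ^ 2 * monom 1 (card D))"
  proof (rule sum.cong)
    fix D assume D: "D \<in> Pow L - {L}"
    then have "\<not> L \<subseteq> D" "\<not> L \<subseteq> insert h D" "L \<inter> D = D" "L \<inter> insert h D = D"
      using L(2) by auto
    then have "star_rank L h D = 2 + card D" "star_rank L h (insert h D) = 2 + card D"
      by (simp_all add: star_rank_def)
    then show "?m D + ?m (insert h D) = 2 * [:0, 1:] ^ 2 * monom 1 (card D)"
      by (simp only: monom_altdef power_add smult_1_left)
  qed simp
  also have "\<dots> = 2 * [:0, 1:] ^ 2 * ((\<Sum>D\<in>Pow L. monom 1 (card D)) - monom 1 (card L))"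
    using L(1) by (simp only: sum_distrib_left[symmetric] sum_diff1 finite_Pow_iff Pow_top if_True)
  finally show ?thesis
    unfolding sum_monom_card_subsets[OF L(1)] by (simp only: monom_altdef smult_1_left)
qed

section \<open>Partial Petrials of a bouquet with a star as intersection graph\<close>

context based_bouquet
begin

lemma partial_petrial_simps [simp]:
  "vdiscs (partial_petrial G A) = vdiscs G" "ribbons (partial_petrial G A) = ribbons G"
  "corners (partial_petrial G A) = corners G" "disc_of (partial_petrial G A) = disc_of G"
  "ribbon_of (partial_petrial G A) = ribbon_of G" "seg (partial_petrial G A) = seg G"
  "gap (partial_petrial G A) = gap G"
  by (simp_all add: partial_petrial_def)

lemma based_bouquet_partial_petrial: "based_bouquet (partial_petrial G A) base"
  unfolding based_bouquet_def based_bouquet_axioms_def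
  using ribbon_graph_partial_petrial one_disc base_in by simp

lemma next_half_edge_partial_petrial: "next_half_edge (partial_petrial G A) = next_half_edge G"
  by (simp add: next_half_edge_def fun_eq_iff)

lemma half_edges_partial_petrial: "half_edges (partial_petrial G A) = half_edges G"
  by (simp add: half_edges_def)

lemma interlaced_partial_petrial: "interlaced (partial_petrial G A) = interlaced G"
  by (simp add: interlaced_def fun_eq_iff next_half_edge_partial_petrial half_edges_partial_petrial)

text \<open>
  The walk around the vertex-disc does not involve the sides, so the corners \<open>corner_at k\<close> are the same in
  the partial Petrial; for a ribbon in \<open>A\<close> the end of a side is moved across a segment, from a corner at which
  a half-edge is entered to one at which it is left or vice versa.
\<close>

lemma twisted_partial_petrial:
  assumes e: "e \<in> ribbons G"
  shows "based_bouquet.twisted (partial_petrial G A) base e \<longleftrightarrow> twisted e \<noteq> (e \<in> A)"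
proof -
  interpret P: based_bouquet "partial_petrial G A" base
    by (rule based_bouquet_partial_petrial)
  have corner [simp]: "P.corner_at = corner_at"
    by (simp add: fun_eq_iff P.corner_at_def corner_at_def next_half_edge_partial_petrial)
  have word [simp]: "P.word = word"
    by (simp add: fun_eq_iff P.word_def word_def)
  obtain p q where pq: "p < q" "q < period" "{k. k < period \<and> word k = e} = {p, q}"
    using positions[OF e] .
  have "word p = e"
    using pq(3) by blast
  then have side: "side (partial_petrial G A) (corner_at p) =
      (if e \<in> A then seg G (side G (corner_at p)) else side G (corner_at p))"
    by (simp add: partial_petrial_def word_def)
  have "side (partial_petrial G A) (corner_at p) =
      (if P.twisted e then corner_at q else seg G (corner_at q))"
    using P.side_of_first_end[of p q e] pq by (simp add: half_edges_partial_petrial)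
  moreover have "side G (corner_at p) = (if twisted e then corner_at q else seg G (corner_at q))"
    by (rule side_of_first_end[OF pq])
  ultimately show ?thesis
    using side corner_at_neq_seg[of q q] by (auto split: if_splits)
qed

lemma euler_genus_conv_faces:
  "euler_genus G = 1 + int (card (ribbons G)) - int (card (faces G))"
proof -
  obtain v where "vdiscs G = {v}"
    using one_disc by (auto simp: card_1_singleton_iff)
  then show ?thesis
    by (simp add: euler_genus_def num_components_one_disc)
qed

lemma euler_genus_star:
  assumes L: "h \<notin> L" "L \<noteq> {}" "ribbons G = insert h L"
    and star: "\<And>e f. e \<in> ribbons G \<Longrightarrow> f \<in> ribbons G \<Longrightarrow>
      interlaced G e f \<longleftrightarrow> e = h \<and> f \<in> L \<or> e \<in> L \<and> f = h"
  shows "nat (euler_genus G) = star_rank L h {e \<in> ribbons G. twisted e}"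
proof -
  let ?D = "{e \<in> ribbons G. twisted e}"
  have fin: "finite L"
    using L(3) finite_ribbons by simp
  have "interlace_kernel = star_kernel L h ?D"
    unfolding interlace_kernel_def star_kernel_def L(3)[symmetric]
  proof (intro Collect_cong conj_cong refl ball_cong)
    fix X e assume X: "X \<subseteq> ribbons G" and e: "e \<in> ribbons G"
    have "{f \<in> X. interlaced G e f} = {f \<in> X. e = h \<and> f \<in> L \<or> e \<in> L \<and> f = h}"
      using star[OF e] X by blast
    then show "(odd (card {f \<in> X. interlaced G e f}) \<longleftrightarrow> twisted e \<and> e \<in> X) =
      (odd (card {f \<in> X. e = h \<and> f \<in> L \<or> e \<in> L \<and> f = h}) \<longleftrightarrow> e \<in> ?D \<and> e \<in> X)"
      using e by simp
  qed
  then have "star_rank L h ?D + card (faces G) = card L + 2"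
    using star_rank_nullity[OF fin L(1,2), of "card (faces G)" ?D] two_power_faces by simp
  moreover have "card (ribbons G) = card L + 1"
    using L(1,3) fin by simp
  ultimately show ?thesis
    unfolding euler_genus_conv_faces by linarith
qed

end

lemma bouquet_base:
  assumes "bouquet B" "ribbons B \<noteq> {}"
  obtains base where "based_bouquet B base"
proof -
  interpret ribbon_graph B
    using assms(1) by (simp add: bouquet_def)
  obtain e where e: "e \<in> ribbons B"
    using assms(2) by blast
  have "corners B \<noteq> {}"
    using two_segments[OF e] by (auto simp: card_eq_0_iff)
  then obtain base where "base \<in> corners B"
    by blast
  then have "based_bouquet B base"
    using assms(1) ribbon_graph_axioms
    by (simp add: bouquet_def based_bouquet_def based_bouquet_axioms_def)
  then show thesis
    by (rule that)
qed

theorem corollary4p1: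
  fixes B :: "('v, 'e, 'c) ribbon_struct" and i :: nat
  assumes "i \<ge> 2"
    and "bouquet B"
    and "card (ribbons B) = i + 1"
    and "complete_bipartite_digraph i 1 (with_proj (intersection_graph B))"
  shows "partial_petrial_poly B =
    (let z = [:0, 1:] in z ^ i + z ^ (i + 1) + 2 * z ^ 2 * ((1 + z) ^ i - z ^ i))"
proof -
  obtain L V where LV: "ribbons B = L \<union> V" "L \<inter> V = {}" "card L = i" "card V = 1"
    and arcs: "{(e, f) \<in> ribbons B \<times> ribbons B. interlaced B e f} = L \<times> V \<union> V \<times> L"
    using assms(4) by (auto simp: complete_bipartite_digraph_pair_def intersection_graph_def)
  obtain h where V: "V = {h}"
    using LV(4) by (auto simp: card_1_singleton_iff)
  have L: "h \<notin> L" "L \<noteq> {}" "finite L" and ribbons: "ribbons B = insert h L"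
    using LV V assms(1) by (auto intro: card_ge_0_finite)
  have star: "interlaced B e f \<longleftrightarrow> e = h \<and> f \<in> L \<or> e \<in> L \<and> f = h"
    if "e \<in> ribbons B" "f \<in> ribbons B" for e f
  proof -
    have "interlaced B e f \<longleftrightarrow> (e, f) \<in> {(e, f) \<in> ribbons B \<times> ribbons B. interlaced B e f}"
      using that by simp
    then show ?thesis
      unfolding arcs V by auto
  qed
  obtain base where "based_bouquet B base"
    using bouquet_base[OF assms(2)] ribbons by auto
  then interpret based_bouquet B base .
  \<comment> \<open>The set of twisted ribbons of the partial Petrial; \<open>?T\<close> is an involution.\<close>
  let ?T = "\<lambda>A. {e \<in> ribbons B. twisted e \<noteq> (e \<in> A)}"
  have genus: "nat (euler_genus (partial_petrial B A)) = star_rank L h (?T A)" for A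
  proof -
    interpret P: based_bouquet "partial_petrial B A" base
      by (rule based_bouquet_partial_petrial)
    have "nat (euler_genus (partial_petrial B A)) = star_rank L h {e \<in> ribbons B. P.twisted e}"
      using P.euler_genus_star[of h L] L(1,2) ribbons star by (simp add: interlaced_partial_petrial)
    also have "{e \<in> ribbons B. P.twisted e} = ?T A"
      using twisted_partial_petrial[of _ A] by blast
    finally show ?thesis .
  qed
  have "partial_petrial_poly B = (\<Sum>A\<in>Pow (ribbons B). monom 1 (star_rank L h (?T A)))"
    by (simp add: partial_petrial_poly_def genus)
  also have "\<dots> = (\<Sum>D\<in>Pow (insert h L). monom 1 (star_rank L h D))"
    unfolding ribbons[symmetric]
  proof (rule sum.reindex_bij_witness[where i = ?T and j = ?T])
    show "?T (?T A) = A" if "A \<in> Pow (ribbons B)" for A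
      using that by blast
    then show "?T (?T A) = A" if "A \<in> Pow (ribbons B)" for A
      using that .
  qed auto
  finally show ?thesis
    using sum_monom_star_rank[OF L(3,1)] LV(3) by (simp only: Let_def)
qed

end
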